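(* Let $n$ be any positive integer and let $\lambda$ be any infinite cardinal. Let $\tau$ be a $T_1$-topology on $\mathscr{I}_\lambda^{n}$ such that $(\mathscr{I}_\lambda^{n},\tau)$ is a semitopological semigroup. Then the following conditions are equivalent: (i) $(\mathscr{I}_\lambda^{n},\tau)$ is sequentially pracompact; (ii) $(\mathscr{I}_\lambda^{n},\tau)$ is totally countably pracompact; (iii) $(\mathscr{I}_\lambda^{n},\tau)$ is feebly compact.
   Context: For a nonzero cardinal $\lambda$, $\mathscr{I}_\lambda$ is the semigroup of all partial one-to-one transformations of $\lambda$ (injective maps from a subset $\operatorname{dom}\alpha\subseteq\lambda$ into $\lambda$, including the empty map $\boldsymbol{0}$), with operation given by composition of partial maps: $x(\alpha\beta)=(x\alpha)\beta$ for $x\in\operatorname{dom}(\alpha\beta)=\{y\in\operatorname{dom}\alpha : y\alpha\in\operatorname{dom}\beta\}$. The rank of $\alpha$ is $\operatorname{rank}\alpha=|\operatorname{dom}\alpha|$, and $\mathscr{I}_\lambda^n=\{\alpha\in\mathscr{I}_\lambda : \operatorname{rank}\alpha\leqslant n\}$, a subsemigroup of $\mathscr{I}_\lambda$. A semitopological semigroup is a semigroup with a topology for which the semigroup operation is separately continuous (all left and right translations are continuous). A topological space $X$ is: - sequentially pracompact if there is a dense subset $D$ of $X$ such that each sequence of points of $D$ has a subsequence converging in $X$; - totally countably pracompact if there is a dense subset $D$ of $X$ such that each sequence of points of $D$ has a subsequence (regarded as a set of points) with compact closure in $X$; - feebly compact if each locally finite open cover of $X$ is finite. Compact means that every open cover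 has a finite subcover (no separation axiom is included). *)

theory Defs
  imports "HOL-Analysis.Analysis"
begin

section \<open>Topological notions\<close>

definition dense_subset :: "'a topology \<Rightarrow> 'a set \<Rightarrow> bool" where
  "dense_subset X D \<longleftrightarrow> D \<subseteq> topspace X \<and> X closure_of D = topspace X"

definition sequentially_pracompact :: "'a topology \<Rightarrow> bool" where
  "sequentially_pracompact X \<longleftrightarrow>
     (\<exists>D. dense_subset X D \<and>
        (\<forall>x :: nat \<Rightarrow> 'a. range x \<subseteq> D \<longrightarrow>
           (\<exists>r :: nat \<Rightarrow> nat. \<exists>l. strict_mono r \<and> limitin X (x \<circ> r) l sequentially)))"

definition totally_countably_pracompact :: "'a topology \<Rightarrow> bool" where
  "totally_countably_pracompact X \<longleftrightarrow>
     (\<exists>D. dense_subset X D \<and>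
        (\<forall>x :: nat \<Rightarrow> 'a. range x \<subseteq> D \<longrightarrow>
           (\<exists>r :: nat \<Rightarrow> nat. strict_mono r \<and> compactin X (X closure_of (range (x \<circ> r))))))"

definition feebly_compact :: "'a topology \<Rightarrow> bool" where
  "feebly_compact X \<longleftrightarrow>
     (\<forall>\<U>. (\<forall>U\<in>\<U>. openin X U) \<and> \<Union>\<U> = topspace X \<and> locally_finite_in X \<U> \<longrightarrow> finite \<U>)"

definition semitopological_semigroup :: "'a topology \<Rightarrow> ('a \<Rightarrow> 'a \<Rightarrow> 'a) \<Rightarrow> bool" where
  "semitopological_semigroup X mul \<longleftrightarrow>
     (\<forall>a\<in>topspace X. \<forall>b\<in>topspace X. mul a b \<in> topspace X) \<and>
     (\<forall>a\<in>topspace X. \<forall>b\<in>topspace X. \<forall>c\<in>topspace X. mul (mul a b) c = mul a (mul b c)) \<and>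
     (\<forall>a\<in>topspace X. continuous_map X X (\<lambda>x. mul a x)) \<and>
     (\<forall>a\<in>topspace X. continuous_map X X (\<lambda>x. mul x a))"

section \<open>Partial one-to-one transformations\<close>

text \<open>A cardinal is represented by a set \<open>L\<close> of that cardinality, and a partial map by a function
  into the option type that is \<open>None\<close> outside its domain.\<close>

definition partial_bijections :: "'a set \<Rightarrow> ('a \<rightharpoonup> 'a) set" where
  "partial_bijections L = {\<alpha>. dom \<alpha> \<subseteq> L \<and> ran \<alpha> \<subseteq> L \<and> inj_on \<alpha> (dom \<alpha>)}"

text \<open>Finiteness is required explicitly because \<open>card\<close> of an infinite set is \<open>0\<close>.\<close>

definition partial_bijections_le :: "'a set \<Rightarrow> nat \<Rightarrow> ('a \<rightharpoonup> 'a) set" where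
  "partial_bijections_le L n =
     {\<alpha> \<in> partial_bijections L. finite (dom \<alpha>) \<and> card (dom \<alpha>) \<le> n}"

text \<open>Maps act on the right, so in the product \<open>\<alpha>\<beta>\<close> the map \<open>\<alpha>\<close> is applied first.\<close>

definition pcomp :: "('a \<rightharpoonup> 'a) \<Rightarrow> ('a \<rightharpoonup> 'a) \<Rightarrow> ('a \<rightharpoonup> 'a)" where
  "pcomp \<alpha> \<beta> = \<beta> \<circ>\<^sub>m \<alpha>"

text \<open>The algebraic clauses of \<open>semitopological_semigroup\<close> hold automatically for these maps, so
  there that hypothesis only constrains the topology.\<close>

lemma pcomp_assoc: "pcomp (pcomp \<alpha> \<beta>) \<gamma> = pcomp \<alpha> (pcomp \<beta> \<gamma>)"
  unfolding pcomp_def map_comp_def by (rule ext) (simp split: option.split)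

lemma pcomp_closed:
  assumes "\<alpha> \<in> partial_bijections_le L n" "\<beta> \<in> partial_bijections_le L n"
  shows "pcomp \<alpha> \<beta> \<in> partial_bijections_le L n"
proof -
  have sub: "dom (pcomp \<alpha> \<beta>) \<subseteq> dom \<alpha>"
    unfolding pcomp_def dom_def map_comp_def by (auto split: option.splits)
  have fin: "finite (dom \<alpha>)" and le: "card (dom \<alpha>) \<le> n" and domL: "dom \<alpha> \<subseteq> L"
    and inja: "inj_on \<alpha> (dom \<alpha>)"
    using assms(1) unfolding partial_bijections_le_def partial_bijections_def by blast+
  have ranL: "ran \<beta> \<subseteq> L" and injb: "inj_on \<beta> (dom \<beta>)"
    using assms(2) unfolding partial_bijections_le_def partial_bijections_def by blast+
  have some: "\<exists>u. \<alpha> x = Some u \<and> \<beta> u = Some z" if "pcomp \<alpha> \<beta> x = Some z" for x z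
    using that unfolding pcomp_def map_comp_Some_iff .
  have "finite (dom (pcomp \<alpha> \<beta>))" by (rule finite_subset[OF sub fin])
  moreover have "card (dom (pcomp \<alpha> \<beta>)) \<le> n"
    using card_mono[OF fin sub] le by (rule le_trans)
  moreover have "dom (pcomp \<alpha> \<beta>) \<subseteq> L" using sub domL by (rule subset_trans)
  moreover have "ran (pcomp \<alpha> \<beta>) \<subseteq> L"
  proof
    fix z assume "z \<in> ran (pcomp \<alpha> \<beta>)"
    then obtain x where "pcomp \<alpha> \<beta> x = Some z" unfolding ran_def by blast
    then obtain u where "\<beta> u = Some z" using some by blast
    then show "z \<in> L" using ranL ranI by fast
  qed
  moreover have "inj_on (pcomp \<alpha> \<beta>) (dom (pcomp \<alpha> \<beta>))"
  proof (rule inj_onI)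
    fix x y assume x: "x \<in> dom (pcomp \<alpha> \<beta>)" and eq: "pcomp \<alpha> \<beta> x = pcomp \<alpha> \<beta> y"
    from x obtain z where z: "pcomp \<alpha> \<beta> x = Some z" unfolding dom_def by blast
    obtain u where u: "\<alpha> x = Some u" "\<beta> u = Some z" using some[OF z] by blast
    obtain v where v: "\<alpha> y = Some v" "\<beta> v = Some z" using some[OF z[unfolded eq]] by blast
    have "u \<in> dom \<beta>" "v \<in> dom \<beta>" "x \<in> dom \<alpha>" "y \<in> dom \<alpha>"
      using u v unfolding dom_def by simp_all
    note doms = this
    have uv: "u = v" using inj_onD[OF injb _ doms(1,2)] u(2) v(2) by simp
    have "\<alpha> x = \<alpha> y" using u(1) v(1) uv by simp
    then show "x = y" using doms(3,4) by (rule inj_onD[OF inja])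
  qed
  ultimately show ?thesis
    unfolding partial_bijections_le_def partial_bijections_def by blast
qed

end

theory Submission
  imports Defs
begin

text \<open>The sets \<open>{\<beta>. \<beta> a = Some b}\<close> are clopen, so maps of maximal rank are isolated. By the
  \<open>\<Delta>\<close>-system lemma every sequence of isolated points has a subsequence whose graphs form a
  sunflower. The clopen sets separate all points other than its kernel from almost all of that
  subsequence, hence feeble compactness forces it to converge to its kernel. Any map of smaller rank is
  the kernel of a sunflower of maps of maximal rank, which therefore are dense.\<close>

section \<open>Feeble compactness from a dense set\<close>

text \<open>An infinite locally finite open cover, with \<open>{}\<close> discarded, contains a
  sequence of distinct nonempty open sets, and density puts a point of \<open>D\<close> into each.
  Such a sequence has no accumulation point, which contradicts either pracompactness property
  whatever dense set witnesses it.\<close>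

lemma not_feebly_compact_sequence:
  assumes "dense_subset X D" "\<not> feebly_compact X"
  obtains x :: "nat \<Rightarrow> 'a" where "range x \<subseteq> D"
    "\<And>p. p \<in> topspace X \<Longrightarrow> \<exists>V. openin X V \<and> p \<in> V \<and> finite {i. x i \<in> V}"
proof -
  obtain \<U> where op: "\<And>U. U \<in> \<U> \<Longrightarrow> openin X U" and lf: "locally_finite_in X \<U>"
    and inf: "infinite \<U>"
    using assms(2) unfolding feebly_compact_def by blast
  from inf have "infinite (\<U> - {{}})" by simp
  then obtain U :: "nat \<Rightarrow> 'a set" where U: "inj U" "range U \<subseteq> \<U> - {{}}"
    using infinite_countable_subset by blast
  have "\<exists>y. y \<in> D \<and> y \<in> U i" for i
  proof -
    have 1: "U i \<noteq> {}" "openin X (U i)" using U op by auto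
    then obtain z where "z \<in> U i" "z \<in> topspace X" using openin_subset by blast
    then have "z \<in> X closure_of D" using assms(1) unfolding dense_subset_def by simp
    then show ?thesis using 1 \<open>z \<in> U i\<close> unfolding in_closure_of by blast
  qed
  then obtain x where x: "\<And>i. x i \<in> D" "\<And>i. x i \<in> U i" by metis
  show thesis
  proof (rule that)
    show "range x \<subseteq> D" using x by auto
    fix p assume "p \<in> topspace X"
    then obtain V where V: "openin X V" "p \<in> V" "finite {W \<in> \<U>. W \<inter> V \<noteq> {}}"
      using lf unfolding locally_finite_in_def by blast
    have "U ` {i. x i \<in> V} \<subseteq> {W \<in> \<U>. W \<inter> V \<noteq> {}}" using U x by blast
    then have "finite (U ` {i. x i \<in> V})" using V finite_subset by blast
    \<comment> \<open>Injectivity of \<open>U\<close> turns finitely many members meeting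
      \<open>V\<close> into finitely many indices; the points \<open>x i\<close> themselves may
      repeat.\<close>
    then have "finite {i. x i \<in> V}"
      using U(1) finite_imageD inj_on_subset by blast
    with V show "\<exists>V. openin X V \<and> p \<in> V \<and> finite {i. x i \<in> V}" by blast
  qed
qed

text \<open>A neighbourhood of the limit of a subsequence contains \<open>x i\<close> for infinitely
  many indices \<open>i\<close>.\<close>

lemma sequentially_pracompact_imp_feebly_compact:
  assumes "sequentially_pracompact X"
  shows "feebly_compact X"
proof (rule ccontr)
  assume nf: "\<not> feebly_compact X"
  obtain D where D: "dense_subset X D" and
    sub: "\<And>x :: nat \<Rightarrow> 'a. range x \<subseteq> D \<Longrightarrow>
      \<exists>r l. strict_mono r \<and> limitin X (x \<circ> r) l sequentially"
    using assms unfolding sequentially_pracompact_def by blast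
  obtain x :: "nat \<Rightarrow> 'a" where x: "range x \<subseteq> D"
    and fin: "\<And>p. p \<in> topspace X \<Longrightarrow> \<exists>V. openin X V \<and> p \<in> V \<and> finite {i. x i \<in> V}"
    using not_feebly_compact_sequence[OF D nf] by blast
  obtain r l where r: "strict_mono r" and lim: "limitin X (x \<circ> r) l sequentially"
    using sub[OF x] by blast
  obtain V where V: "openin X V" "l \<in> V" "finite {i. x i \<in> V}"
    using fin lim limitin_topspace by metis
  obtain N where N: "\<And>k. k \<ge> N \<Longrightarrow> x (r k) \<in> V"
    using lim V unfolding limitin_sequentially by auto
  have "r ` {N..} \<subseteq> {i. x i \<in> V}" using N by auto
  moreover have "infinite (r ` {N..})"
    using r by (meson finite_imageD infinite_Ici inj_on_subset strict_mono_imp_inj_on subset_UNIV)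
  ultimately show False using V(3) finite_subset by blast
qed

text \<open>The open sets that catch \<open>x i\<close> for only finitely many \<open>i\<close>
  cover the compact closure, so finitely many of them would catch the whole subsequence.\<close>

lemma totally_countably_pracompact_imp_feebly_compact:
  assumes "totally_countably_pracompact X"
  shows "feebly_compact X"
proof (rule ccontr)
  assume nf: "\<not> feebly_compact X"
  obtain D where D: "dense_subset X D" and
    sub: "\<And>x :: nat \<Rightarrow> 'a. range x \<subseteq> D \<Longrightarrow>
      \<exists>r :: nat \<Rightarrow> nat. strict_mono r \<and> compactin X (X closure_of (range (x \<circ> r)))"
    using assms unfolding totally_countably_pracompact_def by blast
  obtain x :: "nat \<Rightarrow> 'a" where x: "range x \<subseteq> D"
    and fin: "\<And>p. p \<in> topspace X \<Longrightarrow> \<exists>V. openin X V \<and> p \<in> V \<and> finite {i. x i \<in> V}"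
    using not_feebly_compact_sequence[OF D nf] by blast
  obtain r :: "nat \<Rightarrow> nat" where r: "strict_mono r" and comp: "compactin X (X closure_of (range (x \<circ> r)))"
    using sub[OF x] by blast
  let ?V = "{V. openin X V \<and> finite {i. x i \<in> V}}"
  have "X closure_of (range (x \<circ> r)) \<subseteq> \<Union>?V"
  proof
    fix p assume "p \<in> X closure_of (range (x \<circ> r))"
    then have "p \<in> topspace X" by (simp add: in_closure_of)
    then show "p \<in> \<Union>?V" using fin by blast
  qed
  then obtain \<F> where \<F>: "finite \<F>" "\<F> \<subseteq> ?V" "X closure_of (range (x \<circ> r)) \<subseteq> \<Union>\<F>"
    using comp unfolding compactin_def by (metis (no_types, lifting) mem_Collect_eq)
  have "range (x \<circ> r) \<subseteq> X closure_of (range (x \<circ> r))"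
    using x D unfolding dense_subset_def by (intro closure_of_subset) auto
  \<comment> \<open>Counting indices rather than points keeps the argument valid when the sequence
    has repeated values.\<close>
  then have "range r \<subseteq> (\<Union>V\<in>\<F>. {i. x i \<in> V})" using \<F>(3) by fastforce
  moreover have "finite (\<Union>V\<in>\<F>. {i. x i \<in> V})" using \<F> by auto
  ultimately have "finite (range r)" using finite_subset by blast
  then show False using r strict_mono_imp_inj_on finite_imageD infinite_UNIV_nat by blast
qed

section \<open>Infinite sunflowers\<close>

text \<open>Greedy choice: the sets up to index \<open>N\<close> have a finite union, each point of
  which lies in only finitely many sets, so some later set avoids that union.\<close>

lemma disjoint_subsequence:
  fixes A :: "nat \<Rightarrow> 'b set"
  assumes fin: "\<And>i. finite (A i)" and few: "\<And>x. finite {i. x \<in> A i}"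
  obtains r :: "nat \<Rightarrow> nat" where "strict_mono r" "\<And>i j. i \<noteq> j \<Longrightarrow> A (r i) \<inter> A (r j) = {}"
proof -
  have "\<exists>k>N. \<forall>j\<le>N. A k \<inter> A j = {}" for N
  proof -
    have "finite (\<Union>x\<in>(\<Union>j\<le>N. A j). {i. x \<in> A i})" using fin few by auto
    then have "finite ({..N} \<union> (\<Union>x\<in>(\<Union>j\<le>N. A j). {i. x \<in> A i}))" by simp
    then obtain k where "k \<notin> {..N} \<union> (\<Union>x\<in>(\<Union>j\<le>N. A j). {i. x \<in> A i})"
      using ex_new_if_finite infinite_UNIV_nat by blast
    then have "k > N" "k \<notin> (\<Union>x\<in>(\<Union>j\<le>N. A j). {i. x \<in> A i})" by auto
    then show ?thesis by blast
  qed
  then obtain f where f: "\<And>N. f N > N" "\<And>N j. j \<le> N \<Longrightarrow> A (f N) \<inter> A j = {}" by metis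
  \<comment> \<open>\<open>A (f N)\<close> avoids every \<open>A j\<close> with
    \<open>j \<le> N\<close>, chosen or not, so iterating \<open>f\<close> makes each new set
    disjoint from all earlier chosen ones.\<close>
  define r where "r = rec_nat 0 (\<lambda>_. f)"
  have rS: "r (Suc k) = f (r k)" for k by (simp add: r_def)
  have mono: "strict_mono r" by (simp add: strict_mono_Suc_iff rS f)
  have disj: "A (r i) \<inter> A (r j) = {}" if "i < j" for i j
  proof -
    obtain k where k: "j = Suc k" "i \<le> k"
      using less_imp_Suc_add[OF \<open>i < j\<close>] by auto
    then have "r i \<le> r k" using mono by (simp add: strict_mono_less_eq)
    from f(2)[OF this] show ?thesis by (simp add: k(1) rS Int_commute)
  qed
  show thesis
  proof (rule that[OF mono])
    show "A (r i) \<inter> A (r j) = {}" if "i \<noteq> j" for i j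
      using that disj[of i j] disj[of j i] by (cases i j rule: linorder_cases) auto
  qed
qed

text \<open>Induction on the size bound. If a point lies in infinitely many sets, pass to these,
  delete the point, and return it to the kernel afterwards; otherwise a pairwise disjoint
  subsequence exists and the kernel is empty.\<close>

lemma sunflower_subsequence:
  fixes A :: "nat \<Rightarrow> 'b set"
  assumes "\<And>i. finite (A i)" "\<And>i. card (A i) \<le> n"
  shows "\<exists>(r :: nat \<Rightarrow> nat) K. strict_mono r \<and> (\<forall>i j. i \<noteq> j \<longrightarrow> A (r i) \<inter> A (r j) = K)"
  using assms
proof (induction n arbitrary: A)
  case 0
  then have "A i = {}" for i by (metis card_0_eq le_zero_eq)
  then show ?case
    by (simp add: strict_mono_def exI[of _ "id :: nat \<Rightarrow> nat"])
next
  case (Suc n)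
  show ?case
  proof (cases "\<exists>x. infinite {i. x \<in> A i}")
    case True
    then obtain x where x: "infinite {i. x \<in> A i}" by blast
    obtain s :: "nat \<Rightarrow> nat" where s: "strict_mono s" "\<And>i. x \<in> A (s i)"
      using infinite_enumerate[OF x] by auto
    have "\<exists>(r :: nat \<Rightarrow> nat) K. strict_mono r \<and> (\<forall>i j. i \<noteq> j \<longrightarrow> (A (s (r i)) - {x}) \<inter> (A (s (r j)) - {x}) = K)"
    proof (rule Suc.IH)
      show "finite (A (s i) - {x})" for i using Suc.prems by simp
      show "card (A (s i) - {x}) \<le> n" for i
        using Suc.prems(1)[of "s i"] Suc.prems(2)[of "s i"] s(2)[of i] by simp
    qed
    then obtain r :: "nat \<Rightarrow> nat" and K where r: "strict_mono r"
      "\<And>i j. i \<noteq> j \<Longrightarrow> (A (s (r i)) - {x}) \<inter> (A (s (r j)) - {x}) = K" by blast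
    have "A ((s \<circ> r) i) \<inter> A ((s \<circ> r) j) = insert x K" if "i \<noteq> j" for i j
      using r(2)[OF that] s(2)[of "r i"] s(2)[of "r j"] by auto
    then show ?thesis using strict_mono_o[OF s(1) r(1)] by blast
  next
    case False
    then show ?thesis using disjoint_subsequence[of A] Suc.prems(1) by metis
  qed
qed

section \<open>Semitopological semigroups of partial bijections\<close>

lemma map_le_partial_bijections_le:
  assumes "\<alpha> \<subseteq>\<^sub>m \<beta>" "\<beta> \<in> partial_bijections_le L n"
  shows "\<alpha> \<in> partial_bijections_le L n"
proof -
  have d: "dom \<alpha> \<subseteq> dom \<beta>" and e: "\<And>x. x \<in> dom \<alpha> \<Longrightarrow> \<alpha> x = \<beta> x"
    using assms(1) map_le_implies_dom_le[OF assms(1)] unfolding map_le_def by auto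
  have "ran \<alpha> \<subseteq> ran \<beta>" using e unfolding ran_def by (force simp: dom_def)
  moreover have "inj_on \<alpha> (dom \<alpha>)" if "inj_on \<beta> (dom \<beta>)"
    using that d e unfolding inj_on_def by (metis subsetD)
  moreover have "finite (dom \<alpha>)" "card (dom \<alpha>) \<le> card (dom \<beta>)" if "finite (dom \<beta>)"
    using that d by (auto intro: finite_subset card_mono)
  ultimately show ?thesis
    using assms(2) d unfolding partial_bijections_le_def partial_bijections_def by auto
qed

text \<open>This makes a map of rank \<open>n\<close> maximal: no other map of the space extends
  it.\<close>

lemma map_le_same_card:
  assumes "\<alpha> \<subseteq>\<^sub>m \<beta>" "finite (dom \<beta>)" "card (dom \<beta>) \<le> card (dom \<alpha>)"
  shows "\<alpha> = \<beta>"
proof -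
  have "dom \<alpha> = dom \<beta>"
    using assms map_le_implies_dom_le card_seteq by metis
  then show ?thesis using assms(1) by (metis map_le_antisym map_le_def)
qed

text \<open>Used contrapositively: two distinct maps are told apart by a pair \<open>(a, b)\<close>
  lying in exactly one of their graphs.\<close>

lemma ext_map_Some: "(\<And>a b. f a = Some b \<longleftrightarrow> g a = Some b) \<Longrightarrow> f = g"
  by (rule ext) (metis option.exhaust)

context
  fixes n :: nat and L :: "'a set" and X :: "('a \<rightharpoonup> 'a) topology"
  assumes n: "n \<ge> 1"
    and inf: "infinite L"
    and top: "topspace X = partial_bijections_le L n"
    and t1: "t1_space X"
    and semi: "semitopological_semigroup X pcomp"
begin

section \<open>Clopen sets given by a prescribed value, and isolated points\<close>

lemma singleton_map_in_topspace: "a \<in> L \<Longrightarrow> b \<in> L \<Longrightarrow> [a \<mapsto> b] \<in> topspace X"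
  unfolding top partial_bijections_le_def partial_bijections_def using n by auto

lemma continuous_map_corner:
  assumes "a \<in> L" "b \<in> L"
  shows "continuous_map X X (\<lambda>\<beta>. pcomp (pcomp [a \<mapsto> a] \<beta>) [b \<mapsto> b])"
proof -
  have "continuous_map X X (\<lambda>x. pcomp [a \<mapsto> a] x)" "continuous_map X X (\<lambda>x. pcomp x [b \<mapsto> b])"
    using semi singleton_map_in_topspace assms unfolding semitopological_semigroup_def by blast+
  from continuous_map_compose[OF this] show ?thesis by (simp add: o_def)
qed

text \<open>The left factor restricts the domain to \<open>a\<close> and the right factor restricts
  the range to \<open>b\<close>. The corner map thus takes only two values, so the preimage of the
  complement of one value is the preimage of the other.\<close>

lemma corner_eq: "pcomp (pcomp [a \<mapsto> a] \<beta>) [b \<mapsto> b] = (if \<beta> a = Some b then [a \<mapsto> b] else Map.empty)"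
  unfolding pcomp_def map_comp_def by (rule ext) (auto split: option.split)

text \<open>Preimage under the corner map of the complement of the empty map, which is open because
  points are closed.\<close>

lemma openin_value:
  assumes "a \<in> L" "b \<in> L"
  shows "openin X {\<beta> \<in> topspace X. \<beta> a = Some b}"
proof -
  have "Map.empty \<in> topspace X"
    unfolding top partial_bijections_le_def partial_bijections_def by auto
  then have "openin X (topspace X - {Map.empty})"
    using t1 by (simp add: t1_space_closedin_singleton openin_diff)
  from openin_continuous_map_preimage[OF continuous_map_corner[OF assms] this]
  have "openin X {\<beta> \<in> topspace X. (if \<beta> a = Some b then [a \<mapsto> b] else Map.empty) \<in> topspace X - {Map.empty}}"
    by (simp add: corner_eq)
  moreover have "{\<beta> \<in> topspace X. (if \<beta> a = Some b then [a \<mapsto> b] else Map.empty) \<in> topspace X - {Map.empty}}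
     = {\<beta> \<in> topspace X. \<beta> a = Some b}"
    using singleton_map_in_topspace[OF assms] by (auto split: if_splits)
  ultimately show ?thesis by simp
qed

text \<open>The same preimage argument with the point \<open>[a \<mapsto> b]\<close> removed
  instead; together the two lemmas give clopen sets.\<close>

lemma openin_not_value:
  assumes "a \<in> L" "b \<in> L"
  shows "openin X {\<beta> \<in> topspace X. \<beta> a \<noteq> Some b}"
proof -
  have "openin X (topspace X - {[a \<mapsto> b]})"
    using t1 singleton_map_in_topspace[OF assms]
    by (simp add: t1_space_closedin_singleton openin_diff)
  from openin_continuous_map_preimage[OF continuous_map_corner[OF assms] this]
  have "openin X {\<beta> \<in> topspace X. (if \<beta> a = Some b then [a \<mapsto> b] else Map.empty) \<in> topspace X - {[a \<mapsto> b]}}"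
    by (simp add: corner_eq)
  moreover have "{\<beta> \<in> topspace X. (if \<beta> a = Some b then [a \<mapsto> b] else Map.empty) \<in> topspace X - {[a \<mapsto> b]}}
     = {\<beta> \<in> topspace X. \<beta> a \<noteq> Some b}"
  proof -
    have "Map.empty \<in> topspace X"
      unfolding top partial_bijections_le_def partial_bijections_def by auto
    moreover have "Map.empty \<noteq> [a \<mapsto> b]" by (metis map_upd_nonempty)
    ultimately show ?thesis by (auto split: if_splits)
  qed
  ultimately show ?thesis by simp
qed

lemma topspace_Some_in_L:
  assumes "\<beta> \<in> topspace X" "\<beta> a = Some b"
  shows "a \<in> L" "b \<in> L"
  using assms unfolding top partial_bijections_le_def partial_bijections_def
  by (auto simp: dom_def ran_def)

lemma topspace_finite_dom: "\<beta> \<in> topspace X \<Longrightarrow> finite (dom \<beta>)"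
  and topspace_card_dom: "\<beta> \<in> topspace X \<Longrightarrow> card (dom \<beta>) \<le> n"
  unfolding top partial_bijections_le_def by auto

text \<open>Prescribing all the values of \<open>\<alpha>\<close> is a finite intersection of open
  sets. Its members extend \<open>\<alpha>\<close>, and a map of rank \<open>n\<close> has no proper
  extension in the space.\<close>

lemma maximal_rank_isolated:
  assumes "\<alpha> \<in> topspace X" "card (dom \<alpha>) = n"
  shows "openin X {\<alpha>}"
proof -
  \<comment> \<open>An empty intersection would be the whole type instead of
    \<open>topspace X\<close>; \<open>n \<ge> 1\<close> excludes this.\<close>
  have ne: "dom \<alpha> \<noteq> {}" using assms(2) n by auto
  have "openin X (\<Inter>a\<in>dom \<alpha>. {\<beta> \<in> topspace X. \<beta> a = Some (the (\<alpha> a))})"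
  proof (intro openin_Inter finite_imageI)
    show "finite (dom \<alpha>)" using topspace_finite_dom assms by blast
  next
    fix S assume "S \<in> (\<lambda>a. {\<beta> \<in> topspace X. \<beta> a = Some (the (\<alpha> a))}) ` dom \<alpha>"
    then obtain a where a: "a \<in> dom \<alpha>" "S = {\<beta> \<in> topspace X. \<beta> a = Some (the (\<alpha> a))}" by blast
    then have "\<alpha> a = Some (the (\<alpha> a))" by auto
    from openin_value[OF topspace_Some_in_L[OF assms(1) this]] show "openin X S"
      using a(2) by simp
  qed (use ne in auto)
  also have "(\<Inter>a\<in>dom \<alpha>. {\<beta> \<in> topspace X. \<beta> a = Some (the (\<alpha> a))}) = {\<alpha>}" (is "?I = _")
  proof
    show "{\<alpha>} \<subseteq> ?I" using assms(1) by auto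
    show "?I \<subseteq> {\<alpha>}"
    proof
      fix \<beta> assume \<beta>: "\<beta> \<in> ?I"
      then have "\<beta> \<in> topspace X" using ne by auto
      moreover have "\<alpha> \<subseteq>\<^sub>m \<beta>" using \<beta> unfolding map_le_def by force
      ultimately show "\<beta> \<in> {\<alpha>}"
        using map_le_same_card[of \<alpha> \<beta>] topspace_finite_dom topspace_card_dom assms(2) by auto
    qed
  qed
  finally show ?thesis .
qed

section \<open>Sunflowers of maps: separation, limits and closures\<close>

text \<open>The graphs of the \<open>\<beta> i\<close> meet pairwise in exactly the graph of the
  kernel \<open>\<alpha>\<close>. Indexing by \<open>i \<noteq> j\<close> permits repeated petals,
  but a repeated petal must equal \<open>\<alpha>\<close>.\<close>

definition sunflower :: "(nat \<Rightarrow> ('a \<rightharpoonup> 'a)) \<Rightarrow> ('a \<rightharpoonup> 'a) \<Rightarrow> bool" where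
  "sunflower \<beta> \<alpha> \<longleftrightarrow> range \<beta> \<subseteq> topspace X \<and>
    (\<forall>i j a b. i \<noteq> j \<longrightarrow> (\<beta> i a = Some b \<and> \<beta> j a = Some b \<longleftrightarrow> \<alpha> a = Some b))"

lemma sunflower_kernel_le: "sunflower \<beta> \<alpha> \<Longrightarrow> \<alpha> a = Some b \<Longrightarrow> \<beta> i a = Some b"
  unfolding sunflower_def by (metis n_not_Suc_n)

lemma sunflower_topspace:
  assumes "sunflower \<beta> \<alpha>"
  shows "\<alpha> \<in> topspace X" "\<beta> i \<in> topspace X"
proof -
  show "\<beta> i \<in> topspace X" for i using assms unfolding sunflower_def by auto
  then have "\<beta> 0 \<in> partial_bijections_le L n" using top by simp
  moreover have "\<alpha> \<subseteq>\<^sub>m \<beta> 0"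
    unfolding map_le_def using sunflower_kernel_le[OF assms] by (auto simp: dom_def)
  ultimately show "\<alpha> \<in> topspace X" using map_le_partial_bijections_le top by metis
qed

text \<open>Take a pair in exactly one of the graphs of \<open>\<gamma>\<close> and
  \<open>\<alpha>\<close>. If it belongs to \<open>\<gamma>\<close>, at most one petal contains it;
  if it belongs to \<open>\<alpha>\<close>, every petal does, so the complementary clopen set
  contains no petal.\<close>

lemma sunflower_separation:
  assumes "sunflower \<beta> \<alpha>" "\<gamma> \<in> topspace X" "\<gamma> \<noteq> \<alpha>"
  obtains V where "openin X V" "\<gamma> \<in> V" "\<And>i j. \<beta> i \<in> V \<Longrightarrow> \<beta> j \<in> V \<Longrightarrow> i = j"
proof -
  obtain a b where ab: "\<gamma> a = Some b \<longleftrightarrow> \<alpha> a \<noteq> Some b"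
    using assms(3) ext_map_Some[of \<gamma> \<alpha>] by blast
  have L: "a \<in> L" "b \<in> L"
    using ab topspace_Some_in_L assms(2) sunflower_topspace(1)[OF assms(1)] by metis+
  show thesis
  proof (cases "\<gamma> a = Some b")
    case True
    show thesis
      using that[OF openin_value[OF L]] True ab assms(1,2) unfolding sunflower_def by blast
  next
    case False
    show thesis
      using that[OF openin_not_value[OF L]] False ab assms(2) sunflower_kernel_le[OF assms(1)]
      by blast
  qed
qed

text \<open>The petals outside a neighbourhood \<open>U\<close> of the kernel are open singletons
  forming a locally finite family, so feeble compactness leaves only finitely many of them.\<close>

lemma sunflower_limit:
  assumes fc: "feebly_compact X" and sf: "sunflower \<beta> \<alpha>" and iso: "\<And>i. openin X {\<beta> i}"
  shows "limitin X \<beta> \<alpha> sequentially"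
  unfolding limitin_def
proof (intro conjI allI impI)
  show "\<alpha> \<in> topspace X" using sunflower_topspace sf by blast
  fix U assume U: "openin X U \<and> \<alpha> \<in> U"
  let ?I = "{i. \<beta> i \<notin> U}"
  \<comment> \<open>Adding \<open>topspace X\<close> turns the family of singletons into a cover and
    costs only one member.\<close>
  let ?F = "insert (topspace X) ((\<lambda>i. {\<beta> i}) ` ?I)"
  have "locally_finite_in X ?F"
    unfolding locally_finite_in_def
  proof (intro conjI ballI)
    show "\<Union>?F \<subseteq> topspace X" using sunflower_topspace[OF sf] by auto
    fix \<gamma> assume \<gamma>: "\<gamma> \<in> topspace X"
    show "\<exists>V. openin X V \<and> \<gamma> \<in> V \<and> finite {W \<in> ?F. W \<inter> V \<noteq> {}}"
    proof (cases "\<gamma> = \<alpha>")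
      case True
      have "{W \<in> ?F. W \<inter> U \<noteq> {}} \<subseteq> {topspace X}" by auto
      then have "finite {W \<in> ?F. W \<inter> U \<noteq> {}}" by (rule finite_subset) simp
      then show ?thesis using U True by blast
    next
      case False
      obtain V where V: "openin X V" "\<gamma> \<in> V" "\<And>i j. \<beta> i \<in> V \<Longrightarrow> \<beta> j \<in> V \<Longrightarrow> i = j"
        using sunflower_separation[OF sf \<gamma> False] by blast
      \<comment> \<open>\<open>V\<close> holds at most one index; if it holds none, the set is empty
        and the value of \<open>SOME\<close> is irrelevant.\<close>
      have "{i. \<beta> i \<in> V} \<subseteq> {SOME i. \<beta> i \<in> V}" using V(3) by (auto intro: someI2)
      then have "finite {i. \<beta> i \<in> V}" by (rule finite_subset) simp
      moreover have "{W \<in> ?F. W \<inter> V \<noteq> {}} \<subseteq> insert (topspace X) ((\<lambda>i. {\<beta> i}) ` {i. \<beta> i \<in> V})"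
        by auto
      ultimately have "finite {W \<in> ?F. W \<inter> V \<noteq> {}}" by (simp add: finite_subset)
      then show ?thesis using V by blast
    qed
  qed
  moreover have "\<forall>W\<in>?F. openin X W" using iso by auto
  moreover have "\<Union>?F = topspace X" using sunflower_topspace[OF sf] by auto
  ultimately have "finite ?F"
    using fc[unfolded feebly_compact_def, rule_format, of ?F] by simp
  \<comment> \<open>Needed to pass from finitely many singletons to finitely many indices: a
    repeated petal equals \<open>\<alpha>\<close>, which lies in \<open>U\<close>, so its index is
    not in \<open>?I\<close>.\<close>
  moreover have "inj_on (\<lambda>i. {\<beta> i}) ?I"
  proof (rule inj_onI, rule ccontr)
    fix i j assume ij: "i \<in> ?I" "{\<beta> i} = {\<beta> j}" "i \<noteq> j"
    have "\<beta> i = \<alpha>"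
      using sf ij(2,3) unfolding sunflower_def by (intro ext_map_Some) (metis singleton_inject)
    with ij U show False by simp
  qed
  ultimately have "finite ?I" by (simp add: finite_image_iff)
  then show "\<forall>\<^sub>F i in sequentially. \<beta> i \<in> U"
    by (simp add: cofinite_eq_sequentially[symmetric] eventually_cofinite)
qed

text \<open>A point other than the kernel has a neighbourhood with at most one petal, and that petal
  is a closed point that can be removed unless it is the point itself.\<close>

lemma sunflower_closure:
  assumes sf: "sunflower \<beta> \<alpha>"
  shows "X closure_of (range \<beta>) \<subseteq> insert \<alpha> (range \<beta>)"
proof
  fix \<gamma> assume \<gamma>: "\<gamma> \<in> X closure_of (range \<beta>)"
  show "\<gamma> \<in> insert \<alpha> (range \<beta>)"
  proof (cases "\<gamma> = \<alpha>")
    case False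
    have "\<gamma> \<in> topspace X" using \<gamma> by (simp add: in_closure_of)
    then obtain V where V: "openin X V" "\<gamma> \<in> V" "\<And>i j. \<beta> i \<in> V \<Longrightarrow> \<beta> j \<in> V \<Longrightarrow> i = j"
      using sunflower_separation[OF sf _ False] by blast
    then obtain i where i: "\<beta> i \<in> V" using \<gamma> by (auto simp: in_closure_of)
    have "openin X (V - {\<beta> i})"
      using t1 V sunflower_topspace[OF sf] by (simp add: t1_space_closedin_singleton openin_diff)
    moreover have "\<beta> j \<notin> V - {\<beta> i}" for j using V(3) i by blast
    ultimately have "\<gamma> \<notin> V - {\<beta> i}" using \<gamma> unfolding in_closure_of by (metis rangeE)
    then show ?thesis using V by blast
  qed simp
qed

section \<open>Existence of sunflowers\<close>

lemma exists_sunflower_subsequence: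
  fixes x :: "nat \<Rightarrow> ('a \<rightharpoonup> 'a)"
  assumes "range x \<subseteq> topspace X"
  obtains r :: "nat \<Rightarrow> nat" and \<alpha> where "strict_mono r" "sunflower (x \<circ> r) \<alpha>"
proof -
  have fin: "finite (Map.graph (x i))" and card: "card (Map.graph (x i)) \<le> n" for i
  proof -
    have "x i \<in> topspace X" using assms by auto
    note f = topspace_finite_dom[OF this] and c = topspace_card_dom[OF this]
    show "finite (Map.graph (x i))" using f by simp
    show "card (Map.graph (x i)) \<le> n"
      using c card_image[OF inj_on_fst_graph, of "x i"] by (simp add: fst_graph_eq_dom)
  qed
  obtain r :: "nat \<Rightarrow> nat" and K where r: "strict_mono r"
    "\<And>i j. i \<noteq> j \<Longrightarrow> Map.graph (x (r i)) \<inter> Map.graph (x (r j)) = K"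
    using sunflower_subsequence[of "\<lambda>i. Map.graph (x i)", OF fin card] by blast
  \<comment> \<open>The kernel \<open>K\<close> is a set of pairs contained in the graph of
    \<open>x (r 0)\<close>, so restricting that map to the first coordinates of \<open>K\<close>
    gives the map with graph \<open>K\<close>.\<close>
  define \<alpha> where "\<alpha> = x (r 0) |` (fst ` K)"
  have K: "K \<subseteq> Map.graph (x (r 0))" using r(2)[of 0 1] by auto
  have \<alpha>: "\<alpha> a = Some b \<longleftrightarrow> (a, b) \<in> K" for a b
  proof
    assume "\<alpha> a = Some b"
    then obtain c where "(a, c) \<in> K" "x (r 0) a = Some b"
      by (auto simp: \<alpha>_def restrict_map_def split: if_splits)
    then show "(a, b) \<in> K" using K by (auto simp: Map.graph_def)
  next
    assume "(a, b) \<in> K"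
    then show "\<alpha> a = Some b" using K by (force simp: \<alpha>_def restrict_map_def Map.graph_def)
  qed
  have "sunflower (x \<circ> r) \<alpha>"
    unfolding sunflower_def
  proof (intro conjI allI impI)
    show "range (x \<circ> r) \<subseteq> topspace X" using assms by auto
    fix i j :: nat and a b assume "i \<noteq> j"
    from r(2)[OF this]
    show "((x \<circ> r) i a = Some b \<and> (x \<circ> r) j a = Some b) = (\<alpha> a = Some b)"
      unfolding \<alpha> by (auto simp: Map.graph_def)
  qed
  with r(1) that show thesis by blast
qed

text \<open>Extend \<open>\<alpha>\<close> by the identity on \<open>m\<close> fresh points, using a
  different block of points for each index.\<close>

lemma exists_sunflower_maximal_rank:
  assumes \<alpha>: "\<alpha> \<in> topspace X"
  obtains \<beta> where "sunflower \<beta> \<alpha>" "\<And>i. card (dom (\<beta> i)) = n"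
proof -
  define m where "m = n - card (dom \<alpha>)"
  have fin: "finite (dom \<alpha>)" and card: "card (dom \<alpha>) \<le> n"
    using \<alpha> topspace_finite_dom topspace_card_dom by auto
  have sub: "dom \<alpha> \<subseteq> L" "ran \<alpha> \<subseteq> L" and inj: "inj_on \<alpha> (dom \<alpha>)"
    using \<alpha> unfolding top partial_bijections_le_def partial_bijections_def by auto
  have "infinite (L - (dom \<alpha> \<union> ran \<alpha>))" 
    using inf fin by (simp add: Diff_infinite_finite finite_ran)
  then obtain g :: "nat \<Rightarrow> 'a" where g: "inj g" "range g \<subseteq> L - (dom \<alpha> \<union> ran \<alpha>)"
    using infinite_countable_subset by blast
  \<comment> \<open>Consecutive blocks of length \<open>m\<close> in the enumeration
    \<open>g\<close> of fresh points. For \<open>m = 0\<close> they are all empty and every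
    \<open>\<beta> i\<close> is \<open>\<alpha>\<close>.\<close>
  define B where "B i = g ` {i * m..<i * m + m}" for i
  define \<beta> where "\<beta> i a = (if a \<in> B i then Some a else \<alpha> a)" for i a
  have B: "finite (B i)" "card (B i) = m" "B i \<subseteq> L" "B i \<inter> dom \<alpha> = {}" "B i \<inter> ran \<alpha> = {}" for i
    using g unfolding B_def by (auto simp: card_image inj_on_subset)
  have Bdisj: "B i \<inter> B j = {}" if "i \<noteq> j" for i j
  proof -
    have "{i * m..<i * m + m} \<inter> {j * m..<j * m + m} = {}" if "i < j" for i j
    proof -
      have "Suc i * m \<le> j * m" using that by (intro mult_le_mono1) simp
      then show ?thesis by auto
    qed
    then have "{i * m..<i * m + m} \<inter> {j * m..<j * m + m} = {}"
      using that by (metis inf_commute linorder_neqE_nat)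
    then show ?thesis unfolding B_def using g(1) by (metis image_Int image_empty)
  qed
  have dom: "dom (\<beta> i) = B i \<union> dom \<alpha>" for i by (auto simp: \<beta>_def dom_def split: if_splits)
  have ran: "ran (\<beta> i) \<subseteq> B i \<union> ran \<alpha>" for i by (auto simp: \<beta>_def ran_def split: if_splits)
  have card': "card (dom (\<beta> i)) = n" for i
    unfolding dom using B fin card by (simp add: card_Un_disjoint m_def)
  have "inj_on (\<beta> i) (dom (\<beta> i))" for i
    unfolding dom
  proof (rule inj_onI)
    fix a b assume ab: "a \<in> B i \<union> dom \<alpha>" "b \<in> B i \<union> dom \<alpha>" "\<beta> i a = \<beta> i b"
    \<comment> \<open>Fresh points avoid \<open>ran \<alpha>\<close> as well as
      \<open>dom \<alpha>\<close>, so the new values cannot collide with old ones.\<close>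
    have r: "\<alpha> c \<noteq> Some d" if "d \<in> B i" for c d using B(5)[of i] that by (auto simp: ran_def)
    show "a = b"
    proof (cases "a \<in> B i \<or> b \<in> B i")
      case True
      then show ?thesis using ab(3) r[of a b] r[of b a] unfolding \<beta>_def by (auto split: if_splits)
    next
      case False
      then have "a \<in> dom \<alpha>" "b \<in> dom \<alpha>" "\<alpha> a = \<alpha> b" using ab by (auto simp: \<beta>_def)
      then show ?thesis using inj by (metis inj_onD)
    qed
  qed
  moreover have "dom (\<beta> i) \<subseteq> L" "ran (\<beta> i) \<subseteq> L" "finite (dom (\<beta> i))" for i
    using dom[of i] ran[of i] B(1,3)[of i] sub fin by auto
  ultimately have \<beta>_top: "\<beta> i \<in> topspace X" for i
    unfolding top partial_bijections_le_def partial_bijections_def using card' by simp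
  have \<beta>_kernel: "\<beta> i a = Some b \<and> \<beta> j a = Some b \<longleftrightarrow> \<alpha> a = Some b" if "i \<noteq> j" for i j a b
  proof
    assume "\<beta> i a = Some b \<and> \<beta> j a = Some b"
    \<comment> \<open>The point \<open>a\<close> lies in at most one of the two blocks, so one of
      the two maps agrees with \<open>\<alpha>\<close> at \<open>a\<close>.\<close>
    then show "\<alpha> a = Some b" using Bdisj[OF that] unfolding \<beta>_def by (auto split: if_splits)
  next
    assume *: "\<alpha> a = Some b"
    then have "a \<notin> B k" for k using B(4)[of k] by auto
    with * show "\<beta> i a = Some b \<and> \<beta> j a = Some b" unfolding \<beta>_def by simp
  qed
  have "sunflower \<beta> \<alpha>"
    unfolding sunflower_def
  proof (intro conjI allI impI)
    show "range \<beta> \<subseteq> topspace X" using \<beta>_top by auto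
  qed (rule \<beta>_kernel)
  with card' that show thesis by blast
qed

section \<open>The dense set of maps of maximal rank\<close>

text \<open>Every map is the kernel of a sunflower of isolated petals of rank \<open>n\<close>, and
  feeble compactness makes these converge to it.\<close>

lemma maximal_rank_dense:
  assumes fc: "feebly_compact X"
  shows "dense_subset X {\<beta> \<in> topspace X. card (dom \<beta>) = n}" (is "dense_subset X ?D")
  unfolding dense_subset_def
proof (intro conjI subset_antisym subsetI)
  fix \<alpha> assume "\<alpha> \<in> topspace X"
  then obtain \<beta> where \<beta>: "sunflower \<beta> \<alpha>" "\<And>i. card (dom (\<beta> i)) = n"
    using exists_sunflower_maximal_rank by blast
  then have "limitin X \<beta> \<alpha> sequentially"
    using sunflower_limit[OF fc] maximal_rank_isolated sunflower_topspace by blast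
  moreover have "range \<beta> \<subseteq> ?D" using \<beta> sunflower_topspace by blast
  ultimately show "\<alpha> \<in> X closure_of ?D"
    unfolding in_closure_of limitin_sequentially by (meson le_refl range_subsetD)
qed (auto simp: in_closure_of)

text \<open>One sunflower subsequence serves both pracompactness properties: it converges to its
  kernel, and its closure is just the sequence with its limit, hence compact.\<close>

lemma maximal_rank_subsequence:
  assumes fc: "feebly_compact X" and x: "range x \<subseteq> {\<beta> \<in> topspace X. card (dom \<beta>) = n}"
  obtains r :: "nat \<Rightarrow> nat" and \<alpha> where "strict_mono r" "limitin X (x \<circ> r) \<alpha> sequentially"
    "compactin X (X closure_of (range (x \<circ> r)))"
proof -
  have xt: "range x \<subseteq> topspace X" using x by auto
  obtain r :: "nat \<Rightarrow> nat" and \<alpha> where r: "strict_mono r" and sf: "sunflower (x \<circ> r) \<alpha>"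
    using exists_sunflower_subsequence[OF xt] by blast
  have lim: "limitin X (x \<circ> r) \<alpha> sequentially"
    by (rule sunflower_limit[OF fc sf], rule maximal_rank_isolated) (use x in auto)
  let ?C = "X closure_of (range (x \<circ> r))"
  have sub: "range (x \<circ> r) \<subseteq> topspace X" using xt by auto
  have "\<alpha> \<in> ?C"
    using lim unfolding in_closure_of limitin_sequentially by blast
  then have "?C = insert \<alpha> (range (x \<circ> r))"
    using sunflower_closure[OF sf] closure_of_subset[OF sub] by auto
  then have "compactin X ?C" using compactin_sequence_with_limit[OF lim subset_refl sub] by simp
  with r lim that show thesis by blast
qed

end

theorem theorem8:
  fixes n :: nat and L :: "'a set" and X :: "('a \<rightharpoonup> 'a) topology"
  assumes "n \<ge> 1"
    and "infinite L"
    and "topspace X = partial_bijections_le L n"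
    and "t1_space X"
    and "semitopological_semigroup X pcomp"
  shows "(sequentially_pracompact X \<longleftrightarrow> totally_countably_pracompact X) \<and>
         (totally_countably_pracompact X \<longleftrightarrow> feebly_compact X)"
proof -
  \<comment> \<open>The maps of rank \<open>n\<close> are the dense witness for both properties; the
    reverse implications hold in every topological space.\<close>
  have "sequentially_pracompact X \<and> totally_countably_pracompact X" if fc: "feebly_compact X"
  proof
    let ?D = "{\<beta> \<in> topspace X. card (dom \<beta>) = n}"
    note dense = maximal_rank_dense[OF assms fc]
    note subseq = maximal_rank_subsequence[OF assms fc]
    show "sequentially_pracompact X"
      unfolding sequentially_pracompact_def
    proof (intro exI[of _ ?D] conjI allI impI dense)
      fix x :: "nat \<Rightarrow> ('a \<rightharpoonup> 'a)" assume "range x \<subseteq> ?D"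
      from subseq[OF this]
      show "\<exists>r :: nat \<Rightarrow> nat. \<exists>l. strict_mono r \<and> limitin X (x \<circ> r) l sequentially" by blast
    qed
    show "totally_countably_pracompact X"
      unfolding totally_countably_pracompact_def
    proof (intro exI[of _ ?D] conjI allI impI dense)
      fix x :: "nat \<Rightarrow> ('a \<rightharpoonup> 'a)" assume "range x \<subseteq> ?D"
      from subseq[OF this]
      show "\<exists>r :: nat \<Rightarrow> nat. strict_mono r \<and> compactin X (X closure_of (range (x \<circ> r)))" by blast
    qed
  qed
  then show ?thesis
    using sequentially_pracompact_imp_feebly_compact
      totally_countably_pracompact_imp_feebly_compact by blast
qed

end
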